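(* In the mirror game on $\{1,\ldots,2n\}$, if Alice is open-book (has no secrets) and has memory of at most $0.2n$ bits, then there is a strategy for Bob against which Alice loses with probability at least $$\frac12\cdot\frac{2n}{2n+1}-\nu(n),$$ where $\nu$ is a negligible function.
   Context: Mirror game: Alice and Bob alternately name numbers from $\{1,2,\ldots,2n\}$, Alice on odd turns $1,3,\ldots$ and Bob on even turns $2,4,\ldots$. A player who names a number that was named before loses (and the other wins); if all $2n$ turns pass without repetition the game is a draw. Open-book Alice with $m$ bits of memory: she has a memory state $x\in\{0,1\}^m$; at the end of each turn $2i$ she draws a fresh random string $r_i$ (of arbitrary length) and from then on has access to all of $(r_1,\ldots,r_i)$. Her strategy consists of a next-move function giving her move from her current memory state and random strings drawn so far, and a state-transition function giving her new memory state from Bob's last move, her current memory state, the turn number and the random strings drawn so far. Bob knows Alice's strategy (both functions), and at every moment knows her current memory state and all random strings she has drawn so far, but not her future random strings; Bob may use his own random coins. A function $f:\mathbb{N}\to\mathbb{R}$ is negligible if for every positive integer $c$ there is $N_c$ with $|f(x)|<x^{-c}$ for all $x>N_c$. *)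

theory Defs
  imports "HOL-Probability.Probability"
begin

definition bits :: "nat \<Rightarrow> bool list set" where
  "bits k = {s. length s = k}"

text \<open>
  \<open>initial\<close> is the memory state before the first turn. The string \<open>r\<^sub>i\<close> has length
  \<open>rand_len i\<close>. \<open>next_move x [r\<^sub>1, \<dots>, r\<^sub>i]\<close> is Alice's move on turn \<open>2 * i + 1\<close>.
  \<open>transition b x t [r\<^sub>1, \<dots>, r\<^sub>i]\<close> is the memory state after turn \<open>t = 2 * i\<close>,
  where \<open>b\<close> is the move Bob has just made; the string \<open>r\<^sub>i\<close>, drawn after \<open>b\<close> was named,
  is available to it.
\<close>

record alice =
  initial :: "bool list"
  rand_len :: "nat \<Rightarrow> nat"
  next_move :: "bool list \<Rightarrow> bool list list \<Rightarrow> nat"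
  transition :: "nat \<Rightarrow> bool list \<Rightarrow> nat \<Rightarrow> bool list list \<Rightarrow> bool list"

definition random_strings :: "alice \<Rightarrow> nat \<Rightarrow> bool list list set" where
  "random_strings A k = {rs. length rs = k \<and> (\<forall>j<k. rs ! j \<in> bits (rand_len A (Suc j)))}"

definition alice_strategy :: "nat \<Rightarrow> nat \<Rightarrow> alice \<Rightarrow> bool" where
  "alice_strategy n m A \<longleftrightarrow>
     initial A \<in> bits m \<and>
     (\<forall>i<n. \<forall>x\<in>bits m. \<forall>rs\<in>random_strings A i. next_move A x rs \<in> {1..2 * n}) \<and>
     (\<forall>i\<in>{1..n}. \<forall>b\<in>{1..2 * n}. \<forall>x\<in>bits m. \<forall>rs\<in>random_strings A i.
        transition A b x (2 * i) rs \<in> bits m)"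

text \<open>
  Bob's coins are a uniform string of \<open>coin_len\<close> bits, to which Alice has no access.
  \<open>bob_move w h x rs\<close> is his move when his coins are \<open>w\<close>, the moves named so far (by both
  players) are \<open>h\<close>, Alice's current memory state is \<open>x\<close> and the strings she has drawn so far are
  \<open>rs\<close>. Since \<open>bob\<close> may be chosen depending on \<open>alice\<close>, he also knows both of her functions.
\<close>

record bob =
  coin_len :: nat
  bob_move :: "bool list \<Rightarrow> nat list \<Rightarrow> bool list \<Rightarrow> bool list list \<Rightarrow> nat"

definition bob_strategy :: "nat \<Rightarrow> bob \<Rightarrow> bool" where
  "bob_strategy n B \<longleftrightarrow> (\<forall>w h x rs. bob_move B w h x rs \<in> {1..2 * n})"

text \<open>
  The moves named in the first \<open>2 * i\<close> turns, and Alice's memory state after them. Play is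
  continued formally past a repetition; only the first repetition decides the game.
\<close>

fun position :: "alice \<Rightarrow> bob \<Rightarrow> bool list list \<Rightarrow> bool list \<Rightarrow> nat \<Rightarrow> nat list \<times> bool list" where
  "position A B rs w 0 = ([], initial A)"
| "position A B rs w (Suc i) =
     (let (h, x) = position A B rs w i;
          a = next_move A x (take i rs);
          b = bob_move B w (h @ [a]) x (take i rs)
      in (h @ [a, b], transition A b x (2 * Suc i) (take (Suc i) rs)))"

definition play :: "nat \<Rightarrow> alice \<Rightarrow> bob \<Rightarrow> bool list list \<Rightarrow> bool list \<Rightarrow> nat list" where
  "play n A B rs w = fst (position A B rs w n)"

text \<open>Turns are numbered from 1, so the move on turn \<open>t\<close> is \<open>h ! (t - 1)\<close>.\<close>

definition first_repetition :: "nat list \<Rightarrow> nat \<Rightarrow> bool" where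
  "first_repetition h t \<longleftrightarrow>
     t \<in> {1..length h} \<and> distinct (take (t - 1) h) \<and> h ! (t - 1) \<in> set (take (t - 1) h)"

definition alice_loses :: "nat list \<Rightarrow> bool" where
  "alice_loses h \<longleftrightarrow> (\<exists>t. odd t \<and> first_repetition h t)"

definition alice_loss_prob :: "nat \<Rightarrow> alice \<Rightarrow> bob \<Rightarrow> real" where
  "alice_loss_prob n A B =
     measure_pmf.prob
       (pair_pmf (pmf_of_set (random_strings A n)) (pmf_of_set (bits (coin_len B))))
       {(rs, w). alice_loses (play n A B rs w)}"

definition negligible_fun :: "(nat \<Rightarrow> real) \<Rightarrow> bool" where
  "negligible_fun f \<longleftrightarrow> (\<forall>c::nat. c > 0 \<longrightarrow> (\<exists>N::nat. \<forall>x>N. \<bar>f x\<bar> < 1 / real x ^ c))"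

text \<open>The uniform distributions above are over finite nonempty sets, as \<open>pmf_of_set\<close> requires.\<close>

lemma finite_bits: "finite (bits k)"
  unfolding bits_def using finite_lists_length_eq[of "UNIV :: bool set" k] by simp

lemma bits_nonempty: "bits k \<noteq> {}"
proof -
  have "replicate k False \<in> bits k"
    by (simp add: bits_def)
  then show ?thesis by blast
qed

lemma finite_random_strings: "finite (random_strings A k)"
proof -
  have "random_strings A k \<subseteq>
    {rs. set rs \<subseteq> (\<Union>j<k. bits (rand_len A (Suc j))) \<and> length rs = k}"
    by (fastforce simp: random_strings_def in_set_conv_nth)
  then show ?thesis
    by (rule finite_subset) (auto intro: finite_lists_length_eq finite_bits)
qed

lemma random_strings_nonempty: "random_strings A k \<noteq> {}"
proof -
  have "map (\<lambda>j. replicate (rand_len A (Suc j)) False) [0..<k] \<in> random_strings A k"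
    by (simp add: random_strings_def bits_def)
  then show ?thesis by blast
qed

end

theory Submission
  imports Defs "HOL-Real_Asymp.Real_Asymp"
begin

text \<open>
  Let \<open>T\<close> be the power of two with \<open>n / 4 < T \<le> n / 2\<close>. In each of his first \<open>T\<close> turns Bob names one
  of the \<open>2 * T\<close> smallest free numbers, chosen uniformly. Once Alice's random strings are fixed, a
  given set \<open>S\<close> of \<open>2 * T\<close> numbers is the set named in this opening for at most
  \<open>1 * 3 * \<dots> * (2 * T - 1) \<le> T ^ T\<close> of the \<open>(2 * T) ^ T\<close> choices of Bob, that is, with probability
  at most \<open>2 ^ (-T)\<close>.

  Match two choices of Bob if they lead Alice to the same memory state but to distinct sets
  \<open>S\<close>, \<open>S'\<close> whose intersection is even. In a maximal matching the sets of the unmatched choices with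
  a given memory state pairwise meet in an odd number of elements; as these sets have even size,
  there are at most \<open>2 * n + 1\<close> of them. Hence the unmatched choices have probability at most
  \<open>2 ^ m * (2 * n + 1) * 2 ^ (-T)\<close>, which is negligible since \<open>T > n / 4\<close> and \<open>m \<le> n / 5\<close>.

  After the opening Bob names only numbers outside \<open>S \<union> S'\<close>. Alice plays identically whether the
  opening was \<open>S\<close> or \<open>S'\<close>. An even number of elements lies outside \<open>S \<union> S'\<close>, so she is the first
  to enter \<open>S \<union> S'\<close>, and thereby loses in at least one of the two worlds. Pairing the two worlds
  gives a losing probability of at least 1/2 on the matched choices.
\<close>

subsection \<open>Combinatorial tools\<close>

lemma oddtown:
  assumes fin: "finite U" and sub: "F \<subseteq> Pow U"
    and odd: "\<And>X. X \<in> F \<Longrightarrow> odd (card X)"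
    and even: "\<And>X Y. X \<in> F \<Longrightarrow> Y \<in> F \<Longrightarrow> X \<noteq> Y \<Longrightarrow> even (card (X \<inter> Y))"
  shows "card F \<le> card U"
proof -
  \<comment> \<open>\<open>D I\<close> is the sum of the members of \<open>I\<close> over \<open>GF(2)\<close>; its inner products with the members of
    \<open>F\<close> recover \<open>I\<close>.\<close>
  define D where "D I = {u \<in> U. odd (card {X \<in> I. u \<in> X})}" for I
  have finF: "finite F"
    using fin sub by (meson finite_Pow_iff finite_subset)
  have key: "odd (card (D I \<inter> Y)) \<longleftrightarrow> Y \<in> I" if "I \<subseteq> F" "Y \<in> F" for I Y
  proof -
    have finI: "finite I" and finY: "finite Y"
      using that finF sub fin by (auto intro: finite_subset)
    have "D I \<inter> Y = {u \<in> Y. odd (card {X \<in> I. u \<in> X})}"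
      using that sub by (auto simp: D_def)
    then have "odd (card (D I \<inter> Y)) \<longleftrightarrow> odd (\<Sum>u\<in>Y. card {X \<in> I. u \<in> X})"
      using finY by (simp add: even_sum_iff)
    also have "(\<Sum>u\<in>Y. card {X \<in> I. u \<in> X}) = (\<Sum>X\<in>I. card {u \<in> Y. u \<in> X})"
      by (rule sum_multicount_gen[OF finY finI]) auto
    also have "\<dots> = (\<Sum>X\<in>I. card (X \<inter> Y))"
      by (intro sum.cong arg_cong[of _ _ card]) auto
    also have "odd \<dots> \<longleftrightarrow> odd (card {X \<in> I. odd (card (X \<inter> Y))})"
      using finI by (simp add: even_sum_iff)
    also have "{X \<in> I. odd (card (X \<inter> Y))} = (if Y \<in> I then {Y} else {})"
      using that odd even by (auto split: if_splits)
    finally show ?thesis by simp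
  qed
  have "inj_on D (Pow F)"
  proof (rule inj_onI)
    fix I J assume IJ: "I \<in> Pow F" "J \<in> Pow F" "D I = D J"
    then have "Y \<in> I \<longleftrightarrow> Y \<in> J" if "Y \<in> F" for Y
      using key[of I Y] key[of J Y] that by simp
    then show "I = J" using IJ by blast
  qed
  then have "card (Pow F) \<le> card (Pow U)"
    using fin by (intro card_inj_on_le) (auto simp: D_def)
  then show ?thesis
    using fin finF by (simp add: card_Pow)
qed

lemma reverse_oddtown:
  assumes fin: "finite U" and sub: "F \<subseteq> Pow U"
    and even: "\<And>X. X \<in> F \<Longrightarrow> even (card X)"
    and odd: "\<And>X Y. X \<in> F \<Longrightarrow> Y \<in> F \<Longrightarrow> X \<noteq> Y \<Longrightarrow> odd (card (X \<inter> Y))"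
  shows "card F \<le> Suc (card U)"
proof -
  \<comment> \<open>A common new element flips all parities.\<close>
  define f where "f X = insert None (Some ` X)" for X :: "'a set"
  have inj: "inj f"
    by (rule injI) (auto simp: f_def)
  have card_f: "card (f X) = Suc (card X)" if "X \<subseteq> U" for X
    using that fin by (auto simp: f_def card_image card_insert_disjoint finite_subset)
  have "card (f ` F) \<le> card (f U)"
  proof (rule oddtown)
    fix X Y assume "X \<in> f ` F" "Y \<in> f ` F" "X \<noteq> Y"
    then obtain X' Y' where XY: "X = f X'" "Y = f Y'" "X' \<in> F" "Y' \<in> F" "X' \<noteq> Y'"
      by auto
    then have "X \<inter> Y = f (X' \<inter> Y')"
      by (auto simp: f_def)
    then show "even (card (X \<inter> Y))"
    proof -
      have "X' \<inter> Y' \<subseteq> U" using XY sub by blast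
      then show ?thesis using XY odd[of X' Y'] card_f[of "X' \<inter> Y'"] \<open>X \<inter> Y = f (X' \<inter> Y')\<close> by simp
    qed
  next
    show "f ` F \<subseteq> Pow (f U)"
      using sub by (fastforce simp: f_def)
  next
    fix X assume "X \<in> f ` F"
    then show "odd (card X)"
      using even card_f sub by auto
  qed (use fin in \<open>simp add: f_def\<close>)
  then show ?thesis
    using inj card_f[of U] by (simp add: card_image inj_on_subset)
qed

section \<open>Maximal matchings in finite graphs\<close>

text \<open>A matching is encoded as an involution \<open>p\<close> on \<open>V\<close> whose fixed
  points are the unmatched vertices. Only maximality under inclusion is asked, so that unmatched
  vertices are pairwise non-adjacent.\<close>

definition maximal_matching :: "'a set \<Rightarrow> ('a \<Rightarrow> 'a \<Rightarrow> bool) \<Rightarrow> ('a \<Rightarrow> 'a) \<Rightarrow> bool" where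
  "maximal_matching V E p \<longleftrightarrow>
     (\<forall>v\<in>V. p v \<in> V \<and> p (p v) = v \<and> (p v \<noteq> v \<longrightarrow> E v (p v))) \<and>
     (\<forall>v\<in>V. \<forall>w\<in>V. p v = v \<and> p w = w \<and> v \<noteq> w \<longrightarrow> \<not> E v w)"

text \<open>Greedy construction: match any adjacent pair, remove it and recurse. Symmetry of
  \<open>E\<close> makes the swap valid from both ends.\<close>

lemma maximal_matching_exists:
  assumes "finite V" and sym: "\<And>v w. E v w \<Longrightarrow> E w v"
  shows "\<exists>p. maximal_matching V E p"
  unfolding maximal_matching_def
  using \<open>finite V\<close>
proof (induction V rule: finite_psubset_induct)
  case (psubset V)
  show ?case
  proof (cases "\<exists>a\<in>V. \<exists>b\<in>V. a \<noteq> b \<and> E a b")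
    case True
    then obtain a b where ab: "a \<in> V" "b \<in> V" "a \<noteq> b" "E a b" by blast
    then have "V - {a, b} \<subset> V" by blast
    from psubset.IH[OF this] obtain p where
      p1: "\<forall>v\<in>V - {a, b}. p v \<in> V - {a, b} \<and> p (p v) = v \<and> (p v \<noteq> v \<longrightarrow> E v (p v))" and
      p2: "\<forall>v\<in>V - {a, b}. \<forall>w\<in>V - {a, b}. p v = v \<and> p w = w \<and> v \<noteq> w \<longrightarrow> \<not> E v w"
      by (elim exE conjE)
    define q where "q = p(a := b, b := a)"
    have q: "q a = b" "q b = a" "\<And>v. v \<in> V - {a, b} \<Longrightarrow> q v = p v"
      using ab by (auto simp: q_def)
    have "q v \<in> V \<and> q (q v) = v \<and> (q v \<noteq> v \<longrightarrow> E v (q v))" if "v \<in> V" for v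
    proof (cases "v \<in> {a, b}")
      case False
      then show ?thesis using that bspec[OF p1, of v] q(3)[of v] q(3)[of "p v"] by auto
    qed (use q ab sym[OF ab(4)] in auto)
    moreover have "\<not> E v w" if "v \<in> V" "w \<in> V" "q v = v" "q w = w" "v \<noteq> w" for v w
    proof -
      have "v \<in> V - {a, b}" "w \<in> V - {a, b}" using that q ab by auto
      then show ?thesis using p2 q(3) that by simp
    qed
    ultimately show ?thesis by blast
  next
    case False
    then show ?thesis by (intro exI[of _ id]) auto
  qed
qed

section \<open>Counting sequences by their possible continuations\<close>

text \<open>The prefixes of \<open>Q\<close> form a tree of depth \<open>T\<close> in which a node
  at level \<open>i\<close> has at most \<open>f i\<close> children. Finiteness is carried along
  because \<open>card\<close> of an infinite set is 0.\<close>

lemma card_lists_le_prod: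
  assumes "\<And>xs. xs \<in> Q \<Longrightarrow> length xs = T"
    and "\<And>i p. i < T \<Longrightarrow> length p = i \<Longrightarrow>
      finite {v. \<exists>s. p @ v # s \<in> Q} \<and> card {v. \<exists>s. p @ v # s \<in> Q} \<le> f i"
  shows "finite Q \<and> card Q \<le> (\<Prod>i<T. f i)"
  using assms
proof (induction T arbitrary: Q)
  case 0
  then have "Q \<subseteq> {[]}" by auto
  then have "finite Q" "card Q \<le> card {[] :: 'a list}"
    by (auto intro: finite_subset simp del: card.insert intro!: card_mono)
  then show ?case by simp
next
  case (Suc T)
  define P where "P = {p. \<exists>v. p @ [v] \<in> Q}"
  have IH: "finite P \<and> card P \<le> (\<Prod>i<T. f i)"
  proof (rule Suc.IH)
    fix i and p :: "'a list" assume ip: "i < T" "length p = i"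
    have "{v. \<exists>s. p @ v # s \<in> P} \<subseteq> {v. \<exists>s. p @ v # s \<in> Q}"
      by (auto simp: P_def)
    then show "finite {v. \<exists>s. p @ v # s \<in> P} \<and> card {v. \<exists>s. p @ v # s \<in> P} \<le> f i"
      using Suc.prems(2)[of i p] ip by (meson card_mono finite_subset le_trans less_SucI)
  qed (use Suc.prems(1) in \<open>fastforce simp: P_def\<close>)
  have V: "finite {v. p @ [v] \<in> Q} \<and> card {v. p @ [v] \<in> Q} \<le> f T" if "p \<in> P" for p
  proof -
    have len: "length p = T" using that Suc.prems(1)[of "p @ [_]"] by (auto simp: P_def)
    have "{v. p @ [v] \<in> Q} \<subseteq> {v. \<exists>s. p @ v # s \<in> Q}" by auto
    then show ?thesis
      using Suc.prems(2)[of T p] len by (meson card_mono finite_subset le_trans lessI)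
  qed
  have Q: "Q = (\<lambda>(p, v). p @ [v]) ` (SIGMA p:P. {v. p @ [v] \<in> Q})" (is "_ = ?g ` ?S")
  proof -
    have "xs \<in> ?g ` ?S" if "xs \<in> Q" for xs
    proof -
      have xs: "xs = butlast xs @ [last xs]"
        using Suc.prems(1)[OF that] by (intro append_butlast_last_id[symmetric]) auto
      then have "butlast xs @ [last xs] \<in> Q" using that by metis
      then have "(butlast xs, last xs) \<in> ?S" by (auto simp: P_def)
      moreover have "xs = ?g (butlast xs, last xs)" using xs by simp
      ultimately show ?thesis by (metis image_eqI)
    qed
    then show ?thesis by auto
  qed
  have S: "finite ?S" using IH V by auto
  then have "finite Q" using Q by (metis finite_imageI)
  have "card Q \<le> card ?S" using S Q by (metis card_image_le)
  also have "\<dots> = (\<Sum>p\<in>P. card {v. p @ [v] \<in> Q})" using IH V by auto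
  also have "\<dots> \<le> (\<Sum>p\<in>P. f T)" using V by (intro sum_mono) auto
  also have "\<dots> \<le> (\<Prod>i<Suc T. f i)" using IH by simp
  finally show ?case using \<open>finite Q\<close> by simp
qed

text \<open>This is AM-GM for the first \<open>T\<close> odd numbers, whose mean is
  \<open>T\<close>. The induction needs \<open>2 * T ^ T \<le> (T + 1) ^ T\<close>, supplied by the
  two top terms of the binomial expansion, each equal to \<open>T ^ T\<close>.\<close>

lemma prod_odd_le_power: "(\<Prod>i<T. 2 * i + 1) \<le> (T::nat) ^ T"
proof (induction T)
  case (Suc T)
  show ?case
  proof (cases T)
    case T: (Suc k)
    have "(T + 1) ^ T = (\<Sum>j\<le>T. (T choose j) * T ^ j)"
      using binomial[of T 1 T] by simp
    also have "\<dots> \<ge> (\<Sum>j\<in>{k, T}. (T choose j) * T ^ j)"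
      by (rule sum_mono2) (auto simp: T)
    also have "(\<Sum>j\<in>{k, T}. (T choose j) * T ^ j) = 2 * T ^ T"
      using T by simp
    finally have "2 * T ^ T * (T + 1) \<le> (T + 1) ^ T * (T + 1)"
      by (rule mult_le_mono1)
    moreover have "T ^ T * (2 * T + 1) \<le> 2 * T ^ T * (T + 1)"
      by (simp add: algebra_simps)
    moreover have "(\<Prod>i<Suc T. 2 * i + 1) \<le> T ^ T * (2 * T + 1)"
      using Suc mult_le_mono1[OF Suc, of "2 * T + 1"] by simp
    ultimately have "(\<Prod>i<Suc T. 2 * i + 1) \<le> (T + 1) ^ T * (T + 1)"
      by (meson le_trans)
    then show ?thesis by (simp only: Suc_eq_plus1[symmetric] power_Suc2)
  qed simp
qed simp

subsection \<open>Runs of the game\<close>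

lemma length_position: "length (fst (position A B rs w i)) = 2 * i"
  by (induction i) (auto simp: Let_def split: prod.splits)

lemma position_prefix:
  assumes "i \<le> j"
  shows "\<exists>g. fst (position A B rs w j) = fst (position A B rs w i) @ g"
  using assms
  by (induction j rule: dec_induct) (auto simp: Let_def split: prod.splits)

text \<open>Lets the strings be cut to a prefix, Bob be replaced, or his coins be changed, as long
  as the first \<open>i\<close> rounds look the same. Bob always answers a history of odd length,
  because Alice has just moved.\<close>

lemma position_cong:
  assumes "take i rs = take i rs'"
    and "\<And>k h x. k < i \<Longrightarrow> length h = 2 * k + 1 \<Longrightarrow>
      bob_move B w h x (take k rs) = bob_move B' w' h x (take k rs)"
  shows "position A B rs w i = position A B' rs' w' i"
  using assms
proof (induction i)
  case (Suc i)
  have take: "take i rs = take i rs'"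
    using Suc.prems(1) by (metis min.absorb1 take_take lessI less_imp_le)
  have IH: "position A B rs w i = position A B' rs' w' i"
    using Suc take by simp
  obtain h x where hx: "position A B' rs' w' i = (h, x)" by fastforce
  have "length h = 2 * i"
    using length_position[of A B' rs' w' i] hx by simp
  then show ?case
    using IH hx take Suc.prems Suc.prems(2)[of i "h @ [next_move A x (take i rs')]" x]
    by (simp add: Let_def)
qed simp

lemma take_random_strings:
  "rs \<in> random_strings A k \<Longrightarrow> i \<le> k \<Longrightarrow> take i rs \<in> random_strings A i"
  by (auto simp: random_strings_def)

text \<open>The number \<open>k\<close> of strings may be smaller than \<open>n\<close>, since the
  analysis of the opening works with the first \<open>T\<close> strings only.\<close>

lemma position_valid:
  assumes A: "alice_strategy n m A" and B: "bob_strategy n B"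
    and rs: "rs \<in> random_strings A k" and "i \<le> k" "k \<le> n"
  shows "snd (position A B rs w i) \<in> bits m" (is ?state)
    and "set (fst (position A B rs w i)) \<subseteq> {1..2 * n}" (is ?moves)
proof -
  have "?state \<and> ?moves"
    using \<open>i \<le> k\<close>
  proof (induction i)
    case 0
    then show ?case using A by (simp add: alice_strategy_def)
  next
    case (Suc i)
    obtain h x where hx: "position A B rs w i = (h, x)" by fastforce
    define a where "a = next_move A x (take i rs)"
    define b where "b = bob_move B w (h @ [a]) x (take i rs)"
    have x: "x \<in> bits m" "set h \<subseteq> {1..2 * n}" using Suc hx by auto
    have i: "i < n" "Suc i \<in> {1..n}" using Suc.prems \<open>k \<le> n\<close> by auto
    have rs': "take i rs \<in> random_strings A i" "take (Suc i) rs \<in> random_strings A (Suc i)"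
      using rs Suc.prems by (auto intro!: take_random_strings[of rs A k])
    have a: "a \<in> {1..2 * n}"
      using A i(1) x(1) rs'(1) unfolding alice_strategy_def a_def by blast
    have b: "b \<in> {1..2 * n}"
      using B unfolding bob_strategy_def b_def by blast
    have "transition A b x (2 * Suc i) (take (Suc i) rs) \<in> bits m"
      using A i(2) b x(1) rs'(2) unfolding alice_strategy_def by blast
    moreover have "position A B rs w (Suc i) = (h @ [a, b], transition A b x (2 * Suc i) (take (Suc i) rs))"
      by (simp add: hx Let_def a_def b_def)
    ultimately show ?case using x a b by simp
  qed
  then show ?state ?moves by auto
qed

lemma next_move_valid:
  assumes A: "alice_strategy n m A" and B: "bob_strategy n B"
    and "rs \<in> random_strings A n" "i < n" "position A B rs w i = (h, x)"
  shows "next_move A x (take i rs) \<in> {1..2 * n}"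
proof -
  have "x \<in> bits m"
    using position_valid(1)[OF A B assms(3), of i w] assms by simp
  moreover have "take i rs \<in> random_strings A i"
    using assms by (auto intro!: take_random_strings[of rs A n])
  ultimately show ?thesis
    using A \<open>i < n\<close> unfolding alice_strategy_def by blast
qed

text \<open>Turn \<open>2 * i + 1\<close> is Alice's, and the formal continuation of play cannot
  undo a first repetition.\<close>

lemma alice_losesI:
  assumes "i < n" "position A B rs w i = (h, x)" "distinct h" "next_move A x (take i rs) \<in> set h"
  shows "alice_loses (play n A B rs w)"
proof -
  have len: "length h = 2 * i" using length_position[of A B rs w i] assms by simp
  obtain b y where "position A B rs w (Suc i) = (h @ [next_move A x (take i rs), b], y)"
    using assms(2) by (auto simp: Let_def)
  then obtain g where g: "play n A B rs w = h @ [next_move A x (take i rs), b] @ g"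
    using position_prefix[of "Suc i" n A B rs w] \<open>i < n\<close> by (auto simp: play_def)
  have "first_repetition (play n A B rs w) (2 * i + 1)"
    using assms len by (simp add: first_repetition_def g nth_append)
  then show ?thesis by (auto simp: alice_loses_def intro!: exI[of _ "2 * i + 1"])
qed

section \<open>Openings in which Bob never repeats\<close>

text \<open>Quantifying over all histories within range, reachable or not, makes this a property of
  Bob alone, inherited by any Bob with the same opening moves.\<close>

definition safe_opening :: "nat \<Rightarrow> nat \<Rightarrow> bob \<Rightarrow> bool" where
  "safe_opening n T B \<longleftrightarrow> (\<forall>w\<in>bits (coin_len B). \<forall>h x rs.
     length h < 2 * T \<longrightarrow> set h \<subseteq> {1..2 * n} \<longrightarrow> bob_move B w h x rs \<notin> set h)"

text \<open>Bob's opening moves are always fresh, so a first repetition in the opening could only be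
  Alice's.\<close>

lemma opening_distinct:
  assumes A: "alice_strategy n m A" and B: "bob_strategy n B" and safe: "safe_opening n T B"
    and rs: "rs \<in> random_strings A n" and w: "w \<in> bits (coin_len B)"
    and draw: "\<not> alice_loses (play n A B rs w)" and "i \<le> T" "T \<le> n"
  shows "distinct (fst (position A B rs w i))"
  using \<open>i \<le> T\<close>
proof (induction i)
  case (Suc i)
  obtain h x where hx: "position A B rs w i = (h, x)" by fastforce
  define a where "a = next_move A x (take i rs)"
  define b where "b = bob_move B w (h @ [a]) x (take i rs)"
  have i: "i < n" using Suc.prems \<open>T \<le> n\<close> by simp
  have h: "distinct h" "length h = 2 * i"
    using Suc hx length_position[of A B rs w i] by auto
  have "set h \<subseteq> {1..2 * n}"
    using position_valid(2)[OF A B rs, of i w] i hx by simp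
  moreover have "a \<in> {1..2 * n}"
    unfolding a_def by (rule next_move_valid[OF A B rs i hx])
  moreover have "length (h @ [a]) < 2 * T" using h Suc.prems by simp
  ultimately have "b \<notin> set (h @ [a])"
    using safe w unfolding safe_opening_def b_def by (metis bot.extremum insert_subset le_sup_iff list.set set_append)
  moreover have "a \<notin> set h"
    using alice_losesI[OF i hx h(1)] draw a_def by blast
  ultimately show ?case
    using h by (simp add: hx Let_def flip: a_def b_def)
qed simp

subsection \<open>Playing in two worlds at once\<close>

text \<open>
  The first \<open>T\<close> moves are those of \<open>B\<close>. From then on the coins \<open>w\<close> and their partner
  \<open>p (take T rs) w\<close> are treated alike: Bob avoids everything named in either opening, so that
  Alice, who is in the same memory state in both, cannot tell the two worlds apart. If
  no such number is left, Alice has already lost in one of the worlds, and the value 1 is arbitrary.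
\<close>

definition two_world_bob ::
  "nat \<Rightarrow> nat \<Rightarrow> alice \<Rightarrow> (bool list list \<Rightarrow> bool list \<Rightarrow> bool list) \<Rightarrow> bob \<Rightarrow> bob" where
  "two_world_bob n T A p B =
     \<lparr>coin_len = coin_len B,
      bob_move = \<lambda>w h x rs.
        if length h < 2 * T then bob_move B w h x rs
        else let C = {1..2 * n} - set h - set (fst (position A B (take T rs) (p (take T rs) w) T))
             in if C = {} then 1 else Min C\<rparr>"

lemma coin_len_two_world_bob [simp]: "coin_len (two_world_bob n T A p B) = coin_len B"
  by (simp add: two_world_bob_def)

lemma bob_strategy_two_world_bob:
  assumes "bob_strategy n B" "n \<ge> 1"
  shows "bob_strategy n (two_world_bob n T A p B)"
proof -
  have "(let C = {1..2 * n} - X - Y in if C = {} then 1 else Min C) \<in> {1..2 * n}" for X Y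
    using Min_in[of "{1..2 * n} - X - Y"] \<open>n \<ge> 1\<close> by (auto simp: Let_def)
  then show ?thesis
    using assms unfolding bob_strategy_def two_world_bob_def by simp
qed

lemma safe_opening_two_world_bob:
  "safe_opening n T B \<Longrightarrow> safe_opening n T (two_world_bob n T A p B)"
  by (simp add: safe_opening_def two_world_bob_def)

lemma bob_move_two_world_bob:
  assumes "2 * T \<le> length h" "fst (position A B (take T rs) (p (take T rs) w) T) = h'"
    "{1..2 * n} - set h - set h' \<noteq> {}"
  shows "bob_move (two_world_bob n T A p B) w h x rs = Min ({1..2 * n} - set h - set h')"
  using assms by (simp add: two_world_bob_def Let_def)

lemma position_two_world_bob:
  "position A (two_world_bob n T A p B) rs w T = position A B (take T rs) w T"
  by (rule position_cong) (auto simp: two_world_bob_def)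

lemma alice_loses_one_world:
  assumes A: "alice_strategy n m A" and B: "bob_strategy n B" and n: "n \<ge> 1" "T \<le> n"
    and rs: "rs \<in> random_strings A n"
    and pw: "p (take T rs) w = w'" "p (take T rs) w' = w"
    and pos: "position A B (take T rs) w T = (h, x)" "position A B (take T rs) w' T = (h', x)"
    and dist: "distinct h" "distinct h'" and neq: "set h \<noteq> set h'"
    and even: "even (card (set h \<inter> set h'))"
  shows "alice_loses (play n A (two_world_bob n T A p B) rs w) \<or>
    alice_loses (play n A (two_world_bob n T A p B) rs w')"
proof (rule ccontr)
  define B' where "B' = two_world_bob n T A p B"
  assume "\<not> ?thesis"
  then have nl: "\<not> alice_loses (play n A B' rs w)" "\<not> alice_loses (play n A B' rs w')"
    by (auto simp: B'_def)
  have B': "bob_strategy n B'"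
    unfolding B'_def by (rule bob_strategy_two_world_bob[OF B n(1)])
  have rsT: "take T rs \<in> random_strings A T"
    using rs n(2) by (rule take_random_strings)
  have sub: "set h \<subseteq> {1..2 * n}" "set h' \<subseteq> {1..2 * n}"
    using position_valid(2)[OF A B rsT order_refl n(2)] pos by (metis fst_conv)+
  have len: "length h = 2 * T" "length h' = 2 * T"
    using length_position[of A B "take T rs" _ T] pos by (metis fst_conv)+
  have card: "card (set h) = 2 * T" "card (set h') = 2 * T"
    using dist len by (auto simp: distinct_card)
  define R where "R = {1..2 * n} - (set h \<union> set h')"
  have cardR: "card R + card (set h \<union> set h') = 2 * n"
    using sub by (simp add: R_def card_Diff_subset card_mono[of "{1..2 * n}", simplified])
  have un: "card (set h \<union> set h') + card (set h \<inter> set h') = 4 * T"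
    using card_Un_Int[of "set h" "set h'"] card by simp
  \<comment> \<open>Inclusion-exclusion gives
    \<open>card R = 2 * n - 4 * T + card (set h \<inter> set h')\<close>.\<close>
  have evenR: "even (card R)"
    using cardR un even by presburger
  \<comment> \<open>The continuation \<open>g\<close> and the memory \<open>y\<close> are common to
    both worlds: Alice's functions do not see the opening, and Bob's choice is symmetric in
    \<open>h\<close> and \<open>h'\<close>.\<close>
  have inv: "\<exists>g y. position A B' rs w i = (h @ g, y) \<and> position A B' rs w' i = (h' @ g, y) \<and>
      distinct g \<and> set g \<subseteq> R" if "T \<le> i" "i \<le> n" for i
    using that
  proof (induction i rule: dec_induct)
    case base
    then show ?case
      by (intro exI[of _ "[]"] exI[of _ x]) (simp add: B'_def position_two_world_bob pos)
  next
    case (step i)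
    then obtain g y where g: "position A B' rs w i = (h @ g, y)" "position A B' rs w' i = (h' @ g, y)"
      "distinct g" "set g \<subseteq> R" by auto
    define a where "a = next_move A y (take i rs)"
    have i: "i < n" using step by simp
    have dg: "distinct (h @ g)" "distinct (h' @ g)"
      using g dist by (auto simp: R_def)
    have "a \<in> {1..2 * n}"
      unfolding a_def by (rule next_move_valid[OF A B' rs i g(1)])
    moreover have "a \<notin> set (h @ g)" "a \<notin> set (h' @ g)"
      using alice_losesI[OF i g(1) dg(1)] alice_losesI[OF i g(2) dg(2)] nl a_def by auto
    ultimately have a: "a \<in> R - set g" by (auto simp: R_def)
    have leng: "length g = 2 * (i - T)"
      using length_position[of A B' rs w i] g(1) len by simp
    \<comment> \<open>As \<open>R\<close> has even size, Alice cannot exhaust it.\<close>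
    have "card (set (g @ [a])) = 2 * (i - T) + 1"
      using a g(3) leng by (simp add: distinct_card)
    then have "set (g @ [a]) \<noteq> R" using evenR by (metis even_plus_one_iff even_mult_iff even_numeral)
    then have ne: "R - set (g @ [a]) \<noteq> {}" using a g(4) by auto
    define b where "b = Min (R - set (g @ [a]))"
    have b: "b \<in> R - set (g @ [a])"
      unfolding b_def using ne by (intro Min_in) (auto simp: R_def)
    \<comment> \<open>In round \<open>i\<close> Bob knows \<open>take i rs\<close>, which still
      contains the strings of the opening. This is why the matching is indexed by
      \<open>take T rs\<close>.\<close>
    have tk: "take T (take i rs) = take T rs" using step by (simp add: min_absorb1)
    have C: "{1..2 * n} - set (h @ g @ [a]) - set h' = R - set (g @ [a])"
      "{1..2 * n} - set (h' @ g @ [a]) - set h = R - set (g @ [a])"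
      by (auto simp: R_def)
    have later: "fst (position A B (take T (take i rs)) (p (take T (take i rs)) w) T) = h'"
      "fst (position A B (take T (take i rs)) (p (take T (take i rs)) w') T) = h"
      unfolding tk pw pos by simp_all
    have "bob_move B' w (h @ g @ [a]) y (take i rs) = Min ({1..2 * n} - set (h @ g @ [a]) - set h')"
      unfolding B'_def using len ne C(1) later(1) by (intro bob_move_two_world_bob) simp_all
    moreover have "bob_move B' w' (h' @ g @ [a]) y (take i rs) = Min ({1..2 * n} - set (h' @ g @ [a]) - set h)"
      unfolding B'_def using len ne C(2) later(2) by (intro bob_move_two_world_bob) simp_all
    ultimately have "bob_move B' w (h @ g @ [a]) y (take i rs) = b"
      "bob_move B' w' (h' @ g @ [a]) y (take i rs) = b"
      unfolding C b_def by auto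
    then show ?case
      using g a b by (intro exI[of _ "g @ [a, b]"] exI) (auto simp: Let_def simp flip: a_def)
  qed
  \<comment> \<open>At the end \<open>g\<close> has \<open>2 * (n - T)\<close> distinct elements
    inside \<open>R\<close>. This leaves at most \<open>2 * T\<close> numbers for both openings
    together, so they coincide.\<close>
  obtain g y where g: "position A B' rs w n = (h @ g, y)" "distinct g" "set g \<subseteq> R"
    using inv[of n] n by auto
  have "length g = 2 * (n - T)"
    using length_position[of A B' rs w n] g(1) len n by simp
  moreover have "length g \<le> card R"
    using g(2,3) by (metis R_def card_mono distinct_card finite_Diff finite_atLeastAtMost)
  ultimately have "card (set h \<union> set h') \<le> 2 * T"
    using cardR n by linarith
  then have "set h = set h \<union> set h'" "set h' = set h \<union> set h'"
    using card by (intro card_seteq; simp)+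
  then show False using neq by simp
qed

lemma card_bits: "card (bits k) = 2 ^ k"
  using card_lists_length_eq[of "UNIV :: bool set" k] by (simp add: bits_def)

text \<open>The error term counts unmatched coins: \<open>2 ^ m\<close> memory states, at most
  \<open>2 * n + 1\<close> opening sets for each by \<open>reverse_oddtown\<close>, and at most
  \<open>M\<close> coins for each set.\<close>

lemma two_world_bob_wins:
  assumes A: "alice_strategy n m A" and B: "bob_strategy n B" and safe: "safe_opening n T B"
    and n: "n \<ge> 1" "T \<le> n"
    and M: "\<And>rs S. rs \<in> random_strings A T \<Longrightarrow>
      card {w \<in> bits (coin_len B). distinct (fst (position A B rs w T)) \<and>
        set (fst (position A B rs w T)) = S} \<le> M"
  shows "\<exists>B'. bob_strategy n B' \<and> coin_len B' = coin_len B \<and> (\<forall>rs\<in>random_strings A n.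
      2 ^ coin_len B \<le> 2 * card {w \<in> bits (coin_len B). alice_loses (play n A B' rs w)} +
        2 ^ m * ((2 * n + 1) * M))"
proof -
  define V where "V = bits (coin_len B)"
  define H where "H rs w = fst (position A B rs w T)" for rs w
  define X where "X rs w = snd (position A B rs w T)" for rs w
  \<comment> \<open>Coins whose opening contains a repetition are left unmatched: Alice has already
    lost there, so they need no partner.\<close>
  define E where "E rs w w' \<longleftrightarrow> distinct (H rs w) \<and> distinct (H rs w') \<and> X rs w = X rs w' \<and>
    set (H rs w) \<noteq> set (H rs w') \<and> even (card (set (H rs w) \<inter> set (H rs w')))" for rs w w'
  have finV: "finite V" by (simp add: V_def finite_bits)
  have "\<exists>q. maximal_matching V (E rs) q" for rs
    using finV by (rule maximal_matching_exists) (auto simp: E_def Int_commute)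
  then obtain p where "\<And>rs. maximal_matching V (E rs) (p rs)"
    by metis
  then have p: "w \<in> V \<Longrightarrow> p rs w \<in> V" "w \<in> V \<Longrightarrow> p rs (p rs w) = w"
      "w \<in> V \<Longrightarrow> p rs w \<noteq> w \<Longrightarrow> E rs w (p rs w)"
      "v \<in> V \<Longrightarrow> w \<in> V \<Longrightarrow> p rs v = v \<Longrightarrow> p rs w = w \<Longrightarrow> v \<noteq> w \<Longrightarrow> \<not> E rs v w" for rs v w
    unfolding maximal_matching_def by blast+
  define B' where "B' = two_world_bob n T A p B"
  have B': "bob_strategy n B'" "coin_len B' = coin_len B" "safe_opening n T B'"
    using bob_strategy_two_world_bob[OF B n(1)] safe_opening_two_world_bob[OF safe]
    by (auto simp: B'_def)
  have "2 ^ coin_len B \<le> 2 * card {w \<in> bits (coin_len B). alice_loses (play n A B' rs w)} +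
      2 ^ m * ((2 * n + 1) * M)" if rs: "rs \<in> random_strings A n" for rs
  proof -
    define rs0 where "rs0 = take T rs"
    have rs0: "rs0 \<in> random_strings A T"
      unfolding rs0_def using rs n(2) by (rule take_random_strings)
    define L where "L = {w \<in> V. alice_loses (play n A B' rs w)}"
    define U where "U = {w \<in> V. distinct (H rs0 w) \<and> p rs0 w = w}"
    define K where "K S = {w \<in> V. distinct (H rs0 w) \<and> set (H rs0 w) = S}" for S
    have fin: "finite L" "finite U" "\<And>S. finite (K S)" using finV by (auto simp: L_def U_def K_def)
    \<comment> \<open>Each coin string is losing for Alice, or the partner of a losing one, or
      unmatched with a repetition-free opening.\<close>
    have "w \<in> L \<union> p rs0 ` L \<union> U" if w: "w \<in> V" for w
    proof (cases "w \<in> L \<or> p rs0 w = w")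
      case True
      have "distinct (H rs0 w)" if "w \<notin> L"
        using opening_distinct[OF A B'(1,3) rs, of w T] that w n B'(2)
        by (simp add: L_def V_def B'_def position_two_world_bob H_def rs0_def)
      then show ?thesis using w True by (auto simp: U_def)
    next
      case False
      then have e: "E rs0 w (p rs0 w)" and pw: "p rs0 w \<in> V" "p rs0 (p rs0 w) = w" using p w by auto
      have "alice_loses (play n A B' rs w) \<or> alice_loses (play n A B' rs (p rs0 w))"
        unfolding B'_def
      proof (rule alice_loses_one_world[OF A B n rs])
        show "position A B (take T rs) w T = (H rs0 w, X rs0 w)"
          "position A B (take T rs) (p rs0 w) T = (H rs0 (p rs0 w), X rs0 w)"
          using e unfolding rs0_def E_def H_def X_def by (auto intro: prod_eqI)
      qed (use e pw in \<open>auto simp: E_def simp flip: rs0_def\<close>)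
      then have "p rs0 w \<in> L" using False w pw(1) by (auto simp: L_def)
      then show ?thesis using pw(2) by (metis UnI1 UnI2 imageI)
    qed
    then have "card V \<le> card (L \<union> p rs0 ` L \<union> U)"
      using fin by (intro card_mono) auto
    also have "\<dots> \<le> card L + card (p rs0 ` L) + card U"
      by (meson add_le_mono1 card_Un_le le_trans)
    also have "\<dots> \<le> 2 * card L + card U"
      using card_image_le[OF fin(1), of "p rs0"] by simp
    finally have VL: "card V \<le> 2 * card L + card U" .
    have Ux: "card {w \<in> U. X rs0 w = x} \<le> (2 * n + 1) * M" for x
    proof -
      define F where "F = (\<lambda>w. set (H rs0 w)) ` {w \<in> U. X rs0 w = x}"
      have finF: "finite F" using fin by (simp add: F_def)
      \<comment> \<open>By maximality, unmatched coins with equal memory and distinct sets are not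
        \<open>E\<close>-related, so their sets meet in an odd number of elements.\<close>
      have "card F \<le> Suc (card {1..2 * n})"
      proof (rule reverse_oddtown)
        show "F \<subseteq> Pow {1..2 * n}"
          using position_valid(2)[OF A B rs0 order_refl n(2)] by (auto simp: F_def H_def)
        show "even (card S)" if "S \<in> F" for S
          using that by (auto simp: F_def U_def H_def distinct_card length_position)
        show "odd (card (S \<inter> S'))" if SS: "S \<in> F" "S' \<in> F" "S \<noteq> S'" for S S'
        proof -
          obtain v w where "v \<in> U" "w \<in> U" "X rs0 v = x" "X rs0 w = x"
            "S = set (H rs0 v)" "S' = set (H rs0 w)" using SS by (auto simp: F_def)
          then show ?thesis using p(4)[where v = v and w = w and rs = rs0] SS(3) by (auto simp: U_def E_def)
        qed
      qed simp
      then have F: "card F \<le> 2 * n + 1" by simp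
      have "{w \<in> U. X rs0 w = x} \<subseteq> (\<Union>S\<in>F. K S)"
        by (auto simp: F_def K_def U_def)
      then have "card {w \<in> U. X rs0 w = x} \<le> card (\<Union>S\<in>F. K S)"
        using finF fin by (intro card_mono) auto
      also have "\<dots> \<le> (\<Sum>S\<in>F. card (K S))" using finF by (rule card_UN_le)
      also have "\<dots> \<le> (\<Sum>S\<in>F. M)"
        using M[OF rs0] by (intro sum_mono) (simp add: K_def V_def H_def)
      also have "\<dots> \<le> (2 * n + 1) * M" using F by (simp add: mult_le_mono1 del: add_mult_distrib mult_Suc)
      finally show ?thesis .
    qed
    have "U = (\<Union>x\<in>bits m. {w \<in> U. X rs0 w = x})"
      using position_valid(1)[OF A B rs0 order_refl n(2)] by (auto simp: X_def)
    then have "card U \<le> (\<Sum>x\<in>bits m. card {w \<in> U. X rs0 w = x})"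
      using card_UN_le[OF finite_bits] by metis
    also have "\<dots> \<le> (\<Sum>x\<in>bits m. (2 * n + 1) * M)" using Ux by (intro sum_mono) auto
    also have "\<dots> = 2 ^ m * ((2 * n + 1) * M)" by (simp add: card_bits)
    finally show ?thesis using VL by (simp add: V_def L_def card_bits)
  qed
  with B'(1,2) show ?thesis by blast
qed

subsection \<open>A random opening\<close>

text \<open>
  In round \<open>i\<close> (from 0) Bob names the free number whose index is the \<open>i\<close>-th entry of \<open>enc w\<close>. All
  indices range over the same power of two, so that \<open>enc\<close> can be a bijection on coin strings.
\<close>

definition opening_bob :: "nat \<Rightarrow> nat \<Rightarrow> (bool list \<Rightarrow> nat list) \<Rightarrow> bob" where
  "opening_bob n L enc = \<lparr>coin_len = L,
     bob_move = \<lambda>w h x rs. let u = sorted_list_of_set ({1..2 * n} - set h); v = enc w ! (length h div 2)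
       in if v < length u then u ! v else 1\<rparr>"

lemma bob_strategy_opening_bob: "n \<ge> 1 \<Longrightarrow> bob_strategy n (opening_bob n L enc)"
proof -
  have "sorted_list_of_set ({1..2 * n} - X) ! v \<in> {1..2 * n}"
    if "v < length (sorted_list_of_set ({1..2 * n} - X))" for v X
    using nth_mem[OF that] by simp
  then show "n \<ge> 1 \<Longrightarrow> bob_strategy n (opening_bob n L enc)"
    by (auto simp: bob_strategy_def opening_bob_def Let_def simp del: length_sorted_list_of_set)
qed

text \<open>Fewer than \<open>2 * T\<close> numbers are taken, so more than
  \<open>2 * n - 2 * T \<ge> 2 * T\<close> are free. Every index is therefore valid and the default
  move 1 never occurs in the opening.\<close>

lemma bob_move_opening_bob:
  assumes enc: "length (enc w) = T" "set (enc w) \<subseteq> {..<2 * T}" and T: "2 * T \<le> n"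
    and h: "length h < 2 * T" "set h \<subseteq> {1..2 * n}"
  defines "u \<equiv> sorted_list_of_set ({1..2 * n} - set h)" and "v \<equiv> enc w ! (length h div 2)"
  shows "v < length u" "bob_move (opening_bob n L enc) w h x rs = u ! v"
proof -
  have "length u = 2 * n - card (set h)"
    using h(2) by (simp add: u_def card_Diff_subset)
  moreover have "card (set h) < 2 * T" using h(1) card_length[of h] by simp
  moreover have "length h div 2 < T" using h(1) by simp
  then have "v \<in> set (enc w)" using enc(1) by (simp add: v_def)
  then have "v < 2 * T" using enc(2) by auto
  ultimately show "v < length u" using T by simp
  then show "bob_move (opening_bob n L enc) w h x rs = u ! v"
    by (simp add: opening_bob_def u_def v_def Let_def)
qed

lemma safe_opening_opening_bob:
  assumes enc: "\<And>w. w \<in> bits L \<Longrightarrow> length (enc w) = T \<and> set (enc w) \<subseteq> {..<2 * T}"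
    and T: "2 * T \<le> n"
  shows "safe_opening n T (opening_bob n L enc)"
  unfolding safe_opening_def
proof (intro ballI allI impI)
  fix w h x rs assume a: "w \<in> bits (coin_len (opening_bob n L enc))" "length h < 2 * T" "set h \<subseteq> {1..2 * n}"
  then have w: "w \<in> bits L" by (simp add: opening_bob_def)
  note m = bob_move_opening_bob[where enc = enc and w = w, OF conjunct1[OF enc[OF w]] conjunct2[OF enc[OF w]] T a(2,3)]
  show "bob_move (opening_bob n L enc) w h x rs \<notin> set h"
    using nth_mem[OF m(1)] unfolding m(2) by simp
qed

text \<open>When Bob moves in round \<open>i\<close>, the \<open>2 * i + 1\<close> distinct numbers
  already named must lie in \<open>S\<close>, leaving him \<open>2 * T - (2 * i + 1)\<close> choices
  that stay in \<open>S\<close>. The product of these is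
  \<open>1 * 3 * \<dots> * (2 * T - 1)\<close>.\<close>

lemma card_opening_le:
  assumes A: "alice_strategy n m A" and n: "n \<ge> 1" and T: "2 * T \<le> n"
    and enc: "\<And>w. w \<in> bits L \<Longrightarrow> length (enc w) = T \<and> set (enc w) \<subseteq> {..<2 * T}"
    and inj: "inj_on enc (bits L)"
    and rs: "rs \<in> random_strings A T"
  defines "B \<equiv> opening_bob n L enc"
  shows "card {w \<in> bits L. distinct (fst (position A B rs w T)) \<and> set (fst (position A B rs w T)) = S}
    \<le> T ^ T"
proof -
  define W where "W = {w \<in> bits L. distinct (fst (position A B rs w T)) \<and> set (fst (position A B rs w T)) = S}"
  have B: "bob_strategy n B" unfolding B_def using n by (rule bob_strategy_opening_bob)
  have cS: "card S = 2 * T" if "w \<in> W" for w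
    using that by (auto simp: W_def distinct_card length_position)
  have "card (enc ` W) \<le> (\<Prod>i<T. 2 * T - (2 * i + 1))"
  proof (rule conjunct2[OF card_lists_le_prod])
    fix i and p :: "nat list" assume ip: "i < T" "length p = i"
    define Z where "Z = {v. \<exists>s. p @ v # s \<in> enc ` W}"
    show "finite Z \<and> card Z \<le> 2 * T - (2 * i + 1)"
    proof (cases "Z = {}")
      case False
      then obtain v0 s0 where "p @ v0 # s0 \<in> enc ` W" by (auto simp: Z_def)
      then obtain w0 where w0: "w0 \<in> W" "enc w0 = p @ v0 # s0" by (metis imageE)
      obtain h x where hx: "position A B rs w0 i = (h, x)" by fastforce
      define a where "a = next_move A x (take i rs)"
      define u where "u = sorted_list_of_set ({1..2 * n} - set (h @ [a]))"
      have len: "length h = 2 * i" using length_position[of A B rs w0 i] hx by simp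
      have step: "v < length u \<and> u ! v \<in> S \<and> distinct (h @ [a]) \<and> set (h @ [a]) \<subseteq> S" if v: "v \<in> Z" for v
      proof -
        obtain s where "p @ v # s \<in> enc ` W" using v unfolding Z_def by blast
        then obtain w where w: "w \<in> W" "enc w = p @ v # s" by (metis imageE)
        have wL: "w \<in> bits L" using w by (simp add: W_def)
        \<comment> \<open>The first \<open>i\<close> indices determine play up to round
          \<open>i\<close>, so \<open>h\<close>, \<open>x\<close>, \<open>a\<close> and
          \<open>u\<close> are the same for all coins whose indices begin with
          \<open>p\<close>.\<close>
        have "position A B rs w i = position A B rs w0 i"
        proof (rule position_cong)
          fix k x and h :: "nat list" assume "k < i" "length h = 2 * k + 1"
          then show "bob_move B w h x (take k rs) = bob_move B w0 h x (take k rs)"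
            using w w0 ip by (simp add: B_def opening_bob_def nth_append)
        qed simp
        then have pos: "position A B rs w (Suc i) = (h @ [a, bob_move B w (h @ [a]) x (take i rs)],
            transition A (bob_move B w (h @ [a]) x (take i rs)) x (2 * Suc i) (take (Suc i) rs))"
          by (simp add: hx a_def Let_def)
        obtain g where g: "fst (position A B rs w T) = h @ [a, bob_move B w (h @ [a]) x (take i rs)] @ g"
          using position_prefix[of "Suc i" T A B rs w] ip pos by auto
        then have S: "distinct (h @ [a])" "set (h @ [a]) \<subseteq> S" "bob_move B w (h @ [a]) x (take i rs) \<in> S"
          using w by (auto simp: W_def)
        have "S \<subseteq> {1..2 * n}"
          using position_valid(2)[OF A B rs order_refl, of w] w T by (auto simp: W_def)
        then have sub: "set (h @ [a]) \<subseteq> {1..2 * n}" using S(2) by blast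
        have "length (h @ [a]) < 2 * T" using len ip by simp
        note m = bob_move_opening_bob[where enc = enc and w = w, OF conjunct1[OF enc[OF wL]] conjunct2[OF enc[OF wL]] T this sub,
            folded u_def]
        have "enc w ! (length (h @ [a]) div 2) = v" using w ip len by (simp add: nth_append)
        then show ?thesis using m(1) m(2)[where L = L and x = x and rs = "take i rs"] S by (simp add: B_def)
      qed
      have "card Z \<le> card (S - set (h @ [a]))"
      proof (rule card_inj_on_le)
        show "inj_on ((!) u) Z"
          using step by (intro inj_on_nth) (auto simp: u_def)
        show "(!) u ` Z \<subseteq> S - set (h @ [a])"
        proof (rule image_subsetI)
          fix v assume "v \<in> Z"
          then have v: "v < length u" "u ! v \<in> S" using step by blast+
          have "set u = {1..2 * n} - set (h @ [a])"
            unfolding u_def by (rule set_sorted_list_of_set) simp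
          then show "u ! v \<in> S - set (h @ [a])" using nth_mem[OF v(1)] v(2) by blast
        qed
        show "finite (S - set (h @ [a]))" using w0 by (auto simp: W_def)
      qed
      also have "\<dots> = 2 * T - (2 * i + 1)"
      proof -
        obtain v where "v \<in> Z" using False by blast
        from step[OF this] have ha: "distinct (h @ [a])" "set (h @ [a]) \<subseteq> S" by blast+
        have "card (set (h @ [a])) = 2 * i + 1"
          unfolding distinct_card[OF ha(1)] using len by simp
        then show ?thesis
          unfolding card_Diff_subset[OF finite_set ha(2)] cS[OF w0(1)] by (rule arg_cong)
      qed
      finally have "card Z \<le> 2 * T - (2 * i + 1)" .
      moreover have "Z \<subseteq> {..<length u}" using step by blast
      then have "finite Z" by (rule finite_subset) simp
      ultimately show ?thesis by simp
    qed simp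
  qed (use enc in \<open>auto simp: W_def\<close>)
  also have "(\<Prod>i<T. 2 * T - (2 * i + 1)) = (\<Prod>i<T. 2 * (T - Suc i) + 1)"
    by (intro prod.cong) auto
  also have "\<dots> = (\<Prod>i<T. 2 * i + 1)"
    by (rule prod.nat_diff_reindex)
  also have "\<dots> \<le> T ^ T" by (rule prod_odd_le_power)
  finally have "card (enc ` W) \<le> T ^ T" .
  moreover have "card (enc ` W) = card W"
    using inj by (intro card_image) (auto simp: W_def intro: inj_on_subset)
  ultimately show ?thesis by (simp add: W_def)
qed

section \<open>From counting coins to probabilities\<close>

text \<open>Bob's coins are independent of Alice's strings, so a bound valid for each fixed
  \<open>rs\<close> survives averaging over \<open>rs\<close>.\<close>

lemma alice_loss_prob_ge:
  assumes "\<And>rs. rs \<in> random_strings A n \<Longrightarrow>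
    c * 2 ^ coin_len B \<le> real (card {w \<in> bits (coin_len B). alice_loses (play n A B rs w)})"
  shows "c \<le> alice_loss_prob n A B"
proof -
  define R where "R = random_strings A n"
  define V where "V = bits (coin_len B)"
  have R: "finite R" "R \<noteq> {}" and V: "finite V" "V \<noteq> {}"
    by (auto simp: R_def V_def finite_random_strings random_strings_nonempty finite_bits bits_nonempty)
  have cardR: "real (card R) > 0" using R by (simp add: card_gt_0_iff)
  have cardV: "real (card V) = 2 ^ coin_len B" by (simp add: V_def card_bits)
  have pair: "pair_pmf (pmf_of_set R) (pmf_of_set V) = pmf_of_set (R \<times> V)"
    using R V by (intro pmf_eqI) (auto simp: pmf_pair pmf_of_set[OF R(2,1)] pmf_of_set[OF V(2,1)] pmf_of_set[of "R \<times> V"] indicator_def card_cartesian_product)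
  have "(R \<times> V) \<inter> {(rs, w). alice_loses (play n A B rs w)} =
      (SIGMA rs:R. {w \<in> V. alice_loses (play n A B rs w)})" by auto
  then have "alice_loss_prob n A B =
      (\<Sum>rs\<in>R. real (card {w \<in> V. alice_loses (play n A B rs w)})) / (real (card R) * real (card V))"
    using R V unfolding alice_loss_prob_def R_def[symmetric] V_def[symmetric] pair
    by (simp add: measure_pmf_of_set card_cartesian_product)
  moreover have "(\<Sum>rs\<in>R. c * real (card V)) \<le>
      (\<Sum>rs\<in>R. real (card {w \<in> V. alice_loses (play n A B rs w)}))"
    using assms unfolding cardV by (intro sum_mono) (auto simp: R_def V_def)
  moreover have "0 < real (card R) * real (card V)"
    using cardR cardV by simp
  ultimately show ?thesis
    by (simp add: pos_le_divide_eq mult.commute mult.left_commute)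
qed

lemma bob_wins_almost_half:
  assumes A: "alice_strategy n m A" and n: "n \<ge> 1" and T: "2 * 2 ^ j \<le> n"
  shows "\<exists>B. bob_strategy n B \<and>
    alice_loss_prob n A B \<ge> 1 / 2 - (2 * real n + 1) * 2 ^ m / 2 ^ (2 ^ j) / 2"
proof -
  define T :: nat where "T = 2 ^ j"
  \<comment> \<open>Each of the \<open>T\<close> indices takes \<open>Suc j\<close> bits, as
    \<open>2 * T = 2 ^ Suc j\<close>.\<close>
  define L where "L = Suc j * T"
  define C where "C = {xs. set xs \<subseteq> {..<2 * T} \<and> length xs = T}"
  have "card (bits L) = (2 * T) ^ T"
    unfolding card_bits L_def power_mult by (simp add: T_def)
  then have "card (bits L) = card C"
    by (simp add: C_def card_lists_length_eq)
  moreover have "finite C" by (simp add: C_def finite_lists_length_eq)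
  ultimately obtain enc where enc: "bij_betw enc (bits L) C"
    using finite_same_card_bij[OF finite_bits] by blast
  have encL: "length (enc w) = T \<and> set (enc w) \<subseteq> {..<2 * T}" if "w \<in> bits L" for w
    using bij_betwE[OF enc] that by (auto simp: C_def)
  have T2: "2 * T \<le> n" using T by (simp add: T_def)
  define B where "B = opening_bob n L enc"
  have B: "bob_strategy n B" "coin_len B = L" "safe_opening n T B"
    using bob_strategy_opening_bob[OF n] safe_opening_opening_bob[OF encL T2]
    by (simp_all add: B_def opening_bob_def)
  have M: "card {w \<in> bits (coin_len B). distinct (fst (position A B rs w T)) \<and>
      set (fst (position A B rs w T)) = S} \<le> T ^ T" if "rs \<in> random_strings A T" for rs S
    unfolding B(2) unfolding B_def
    by (rule card_opening_le[OF A n T2 encL bij_betw_imp_inj_on[OF enc] that])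
  have "T \<le> n" using T2 by simp
  have "\<exists>B'. bob_strategy n B' \<and> coin_len B' = coin_len B \<and> (\<forall>rs\<in>random_strings A n.
      2 ^ coin_len B \<le> 2 * card {w \<in> bits (coin_len B). alice_loses (play n A B' rs w)} +
        2 ^ m * ((2 * n + 1) * T ^ T))"
    by (rule two_world_bob_wins[OF A B(1,3) n \<open>T \<le> n\<close>]) (rule M)
  then obtain B' where B': "bob_strategy n B'" "coin_len B' = L"
    "\<forall>rs\<in>random_strings A n.
      2 ^ L \<le> 2 * card {w \<in> bits L. alice_loses (play n A B' rs w)} + 2 ^ m * ((2 * n + 1) * T ^ T)"
    unfolding B(2) by (elim exE conjE)
  have "1 / 2 - (2 * real n + 1) * 2 ^ m / 2 ^ T / 2 \<le> alice_loss_prob n A B'"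
  proof (rule alice_loss_prob_ge)
    fix rs assume rs: "rs \<in> random_strings A n"
    define l where "l = card {w \<in> bits L. alice_loses (play n A B' rs w)}"
    define t D N :: real where "t = real T ^ T" and "D = 2 ^ T" and "N = 2 * real n + 1"
    have D: "D > 0" by (simp add: D_def)
    have "real (2 ^ L) \<le> real (2 * l + 2 ^ m * ((2 * n + 1) * T ^ T))"
      using bspec[OF B'(3) rs] unfolding l_def of_nat_le_iff .
    then have le: "2 ^ L \<le> 2 * real l + 2 ^ m * (N * t)"
      unfolding t_def N_def of_nat_add of_nat_mult of_nat_power of_nat_numeral of_nat_1 .
    \<comment> \<open>There are \<open>(2 * T) ^ T\<close> coin strings against at most
      \<open>T ^ T\<close> for each set; the quotient \<open>D = 2 ^ T\<close> is what beats the
      memory factor \<open>2 ^ m\<close>.\<close>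
    have L: "(2::real) ^ L = D * t"
    proof -
      have "(2::real) ^ L = (2 ^ Suc j) ^ T" unfolding L_def power_mult ..
      also have "(2::real) ^ Suc j = 2 * real T" by (simp add: T_def)
      finally show ?thesis by (simp add: D_def t_def power_mult_distrib)
    qed
    have eq: "(1 / 2 - N * 2 ^ m / D / 2) * (D * t) = (D * t - 2 ^ m * (N * t)) / 2"
      using D by (simp add: field_simps)
    have "(1 / 2 - N * 2 ^ m / D / 2) * 2 ^ L \<le> real l"
    proof -
      have "(y - z) / 2 \<le> x" if "y \<le> 2 * x + z" for x y z :: real using that by simp
      then show ?thesis using le unfolding L eq .
    qed
    then show "(1 / 2 - (2 * real n + 1) * 2 ^ m / 2 ^ T / 2) * 2 ^ coin_len B' \<le>
        real (card {w \<in> bits (coin_len B'). alice_loses (play n A B' rs w)})"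
      unfolding B'(2) l_def D_def N_def .
  qed
  then show ?thesis using B'(1) unfolding T_def by blast
qed

section \<open>Asymptotics and the final bound\<close>

text \<open>The rate \<open>1 / 20\<close> is \<open>1 / 4 - 1 / 5\<close>, the gap between the
  opening length \<open>T > n / 4\<close> and the memory \<open>m \<le> n / 5\<close>.\<close>

lemma negligible_fun_exponential: "negligible_fun (\<lambda>n. (2 * real n + 1) * 2 powr (- real n / 20))"
  unfolding negligible_fun_def
proof (intro allI impI)
  fix c :: nat assume "c > 0"
  have "(\<lambda>n. (2 * real n + 1) * 2 powr (- real n / 20) * real n ^ c) \<longlonglongrightarrow> 0"
    by real_asymp
  then have "eventually (\<lambda>n. (2 * real n + 1) * 2 powr (- real n / 20) * real n ^ c < 1) sequentially"
    by (rule order_tendstoD) simp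
  then obtain N where N: "\<And>n. n \<ge> N \<Longrightarrow> (2 * real n + 1) * 2 powr (- real n / 20) * real n ^ c < 1"
    by (auto simp: eventually_sequentially)
  then have "\<forall>x>N. \<bar>(2 * real x + 1) * 2 powr (- real x / 20)\<bar> < 1 / real x ^ c"
    by (auto simp: field_simps)
  then show "\<exists>N. \<forall>x>N. \<bar>(2 * real x + 1) * 2 powr (- real x / 20)\<bar> < 1 / real x ^ c" by blast
qed

theorem theorem4p6:
  "\<exists>\<nu> :: nat \<Rightarrow> real. negligible_fun \<nu> \<and>
     (\<forall>(n::nat) (m::nat) (A::alice).
        n \<ge> 1 \<longrightarrow> real m \<le> 0.2 * real n \<longrightarrow> alice_strategy n m A \<longrightarrow>
        (\<exists>B::bob. bob_strategy n B \<and>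
           alice_loss_prob n A B \<ge> 1 / 2 * (2 * real n / (2 * real n + 1)) - \<nu> n))"
proof (intro exI[of _ "\<lambda>n. (2 * real n + 1) * 2 powr (- real n / 20)"] conjI allI impI)
  show "negligible_fun (\<lambda>n. (2 * real n + 1) * 2 powr (- real n / 20))"
    by (rule negligible_fun_exponential)
next
  fix n m :: nat and A :: alice
  assume n: "n \<ge> 1" and m: "real m \<le> 0.2 * real n" and A: "alice_strategy n m A"
  define \<nu> where "\<nu> = (2 * real n + 1) * 2 powr (- real n / 20)"
  \<comment> \<open>The target constant is at most 1/2, so the stronger bound
    \<open>1 / 2 - \<nu>\<close> is proved instead.\<close>
  have half: "1 / 2 * (2 * real n / (2 * real n + 1)) \<le> 1 / 2"
    by (simp add: field_simps)
  have "\<exists>B. bob_strategy n B \<and> 1 / 2 - \<nu> \<le> alice_loss_prob n A B"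
  \<comment> \<open>For \<open>n = 1\<close> no power of two satisfies \<open>2 * T \<le> n\<close>,
    but there \<open>\<nu> \<ge> 1 / 2\<close> and any Bob will do.\<close>
  proof (cases "n = 1")
    case True
    have "1 / 2 = (2::real) powr (- 1)" by (simp add: powr_minus)
    also have "\<dots> \<le> 2 powr (- real n / 20)"
      using True by (intro powr_mono) auto
    finally have "1 * (1 / 2) \<le> \<nu>"
      unfolding \<nu>_def by (intro mult_mono) auto
    then have "1 / 2 - \<nu> \<le> 0" by simp
    also have "0 \<le> alice_loss_prob n A B" for B
      by (simp add: alice_loss_prob_def)
    finally have "1 / 2 - \<nu> \<le> alice_loss_prob n A B" for B .
    moreover have "bob_strategy n \<lparr>coin_len = 0, bob_move = \<lambda>_ _ _ _. 1\<rparr>"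
      using n by (simp add: bob_strategy_def)
    ultimately show ?thesis by blast
  next
    case False
    \<comment> \<open>\<open>T = 2 ^ j\<close> must satisfy both \<open>2 * T \<le> n\<close>, for the opening, and \<open>T > n / 4\<close>, to beat
      \<open>m \<le> n / 5\<close>.\<close>
    define k where "k = floor_log n"
    have k: "2 ^ k \<le> n" "n < 2 ^ Suc k"
      using n floor_log_exp2_le[of n] floor_log_exp2_gt[of n] by (auto simp: k_def)
    have "k \<noteq> 0"
      using k(2) n False by (cases k) auto
    then obtain j where j: "k = Suc j" by (cases k) auto
    have T: "2 * 2 ^ j \<le> n" "n < 4 * 2 ^ j" using k j by auto
    have "2 ^ m / 2 ^ (2 ^ j) = 2 powr (real m - real (2 ^ j))"
      by (simp only: powr_diff powr_realpow zero_less_numeral)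
    also have "\<dots> \<le> 2 powr (- real n / 20)"
    proof (intro powr_mono)
      have "real n < 4 * real (2 ^ j)" using T(2) by (metis of_nat_less_iff of_nat_mult of_nat_numeral)
      then show "real m - real (2 ^ j) \<le> - real n / 20" using m by simp
    qed simp
    finally have le: "2 ^ m / 2 ^ (2 ^ j) \<le> 2 powr (- real n / 20)" .
    define q where "q = (2 * real n + 1) * 2 ^ m / 2 ^ (2 ^ j)"
    have "q \<le> \<nu>"
      using mult_left_mono[OF le, of "2 * real n + 1"] by (simp add: q_def \<nu>_def)
    moreover have "0 \<le> \<nu>" by (simp add: \<nu>_def)
    moreover obtain B where "bob_strategy n B" "1 / 2 - q / 2 \<le> alice_loss_prob n A B"
      unfolding q_def using bob_wins_almost_half[OF A n T(1)] by blast
    ultimately have "bob_strategy n B \<and> 1 / 2 - \<nu> \<le> alice_loss_prob n A B" by linarith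
    then show ?thesis ..
  qed
  then obtain B where "bob_strategy n B" "1 / 2 - \<nu> \<le> alice_loss_prob n A B" by blast
  with half show "\<exists>B. bob_strategy n B \<and>
      alice_loss_prob n A B \<ge> 1 / 2 * (2 * real n / (2 * real n + 1)) - (2 * real n + 1) * 2 powr (- real n / 20)"
    unfolding \<nu>_def[symmetric] by (intro exI[of _ B]) linarith
qed

end
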